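(* Let $\ell \geq 3$ be an integer and let $n_1,n_2 \geq \ell+2$. Then $$sat(K_{n_1,n_2},C_{2\ell}) \leq n_1+n_2+\ell^2-3\ell+1.$$ Moreover, $sat(K_{n_1,n_2},C_6) = n_1+n_2+1$ (for $n_1,n_2 \ge 5$).
   Context: All graphs are finite, simple and undirected. $K_{n_1,n_2}$ is the complete bipartite graph with parts of sizes $n_1$ and $n_2$. $C_r$ denotes the cycle on $r$ vertices. For graphs $G$ and $F$, a spanning subgraph $H$ of $G$ is $F$-saturated relative to $G$ if $H$ contains no copy of $F$ but $H+e$ contains a copy of $F$ for every $e\in E(G)\setminus E(H)$; $sat(G,F)$ is the minimum number of edges of a graph that is $F$-saturated relative to $G$. *)

theory Defs
  imports Main
begin

datatype 'a ugraph = Graph (verts: "'a set") (edges: "'a set set")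

definition simple_graph :: "'a ugraph \<Rightarrow> bool" where
  "simple_graph G \<longleftrightarrow> finite (verts G) \<and> (\<forall>e\<in>edges G. e \<subseteq> verts G \<and> card e = 2)"

definition complete_bipartite :: "nat \<Rightarrow> nat \<Rightarrow> (nat + nat) ugraph" where
  "complete_bipartite m n = Graph ({..<m} <+> {..<n}) {{Inl i, Inr j} | i j. i < m \<and> j < n}"

text \<open>This is the cycle on \<open>r\<close> vertices only for \<open>r \<ge> 3\<close>.\<close>

definition cycle_graph :: "nat \<Rightarrow> nat ugraph" where
  "cycle_graph r = Graph {..<r} {{i, Suc i mod r} | i. i < r}"

text \<open>Copies are subgraphs, not necessarily induced.\<close>

definition contains_copy :: "'a ugraph \<Rightarrow> 'b ugraph \<Rightarrow> bool" where
  "contains_copy H F \<longleftrightarrow>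
     (\<exists>f. inj_on f (verts F) \<and> f ` verts F \<subseteq> verts H \<and> (\<forall>e\<in>edges F. f ` e \<in> edges H))"

definition add_edge :: "'a ugraph \<Rightarrow> 'a set \<Rightarrow> 'a ugraph" where
  "add_edge H e = Graph (verts H) (insert e (edges H))"

definition spanning_subgraph :: "'a ugraph \<Rightarrow> 'a ugraph \<Rightarrow> bool" where
  "spanning_subgraph H G \<longleftrightarrow> verts H = verts G \<and> edges H \<subseteq> edges G"

definition saturated_in :: "'a ugraph \<Rightarrow> 'b ugraph \<Rightarrow> 'a ugraph \<Rightarrow> bool" where
  "saturated_in G F H \<longleftrightarrow> spanning_subgraph H G \<and> \<not> contains_copy H F \<and>
     (\<forall>e\<in>edges G - edges H. contains_copy (add_edge H e) F)"

definition sat :: "'a ugraph \<Rightarrow> 'b ugraph \<Rightarrow> nat" where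
  "sat G F = (LEAST m. \<exists>H. saturated_in G F H \<and> card (edges H) = m)"

lemma simple_graph_complete_bipartite: "simple_graph (complete_bipartite m n)"
  by (auto simp: simple_graph_def complete_bipartite_def)

lemma simple_graph_cycle_graph:
  assumes "3 \<le> r"
  shows "simple_graph (cycle_graph r)"
proof -
  have "card {i, Suc i mod r} = 2" "Suc i mod r < r" if "i < r" for i
    using that assms by (auto simp: mod_Suc)
  then show ?thesis
    by (auto simp: simple_graph_def cycle_graph_def)
qed

text \<open>The minimum in \<open>sat\<close> is attained whenever \<open>F\<close> has an edge.\<close>

lemma saturated_in_exists:
  assumes "simple_graph G" "edges F \<noteq> {}"
  shows "\<exists>H. saturated_in G F H"
proof -
  define \<F> where "\<F> = {E. E \<subseteq> edges G \<and> \<not> contains_copy (Graph (verts G) E) F}"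
  have "edges G \<subseteq> Pow (verts G)" "finite (verts G)"
    using assms(1) by (auto simp: simple_graph_def)
  then have "finite \<F>"
    unfolding \<F>_def by (auto intro: finite_subset[of _ "Pow (Pow (verts G))"])
  moreover have "{} \<in> \<F>"
    using assms(2) by (auto simp: \<F>_def contains_copy_def)
  ultimately obtain E where E: "E \<in> \<F>" and max: "\<forall>E'\<in>\<F>. E \<subseteq> E' \<longrightarrow> E = E'"
    using finite_has_maximal[of \<F>] by blast
  have "contains_copy (add_edge (Graph (verts G) E) e) F" if "e \<in> edges G - E" for e
  proof (rule ccontr)
    assume "\<not> contains_copy (add_edge (Graph (verts G) E) e) F"
    then have "insert e E \<in> \<F>"
      using that E by (auto simp: \<F>_def add_edge_def)
    then show False using max that by blast
  qed
  then have "saturated_in G F (Graph (verts G) E)"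
    using E by (auto simp: saturated_in_def spanning_subgraph_def \<F>_def)
  then show ?thesis by blast
qed

end

theory Submission
  imports Defs "HOL-Combinatorics.Transposition"
begin

text \<open>Upper bound: take a \<open>K\<^bsub>l,l-1\<^esub>\<close>, which is too small for a \<open>2l\<close>-cycle, attach one further right vertex
  \<open>v\<close> to it, attach all remaining left vertices to \<open>v\<close> and all remaining right vertices to a single
  left vertex of the core. Everything outside the core is a forest hanging off it, so no cycle
  leaves the core, while every missing edge closes a \<open>2l\<close>-cycle through the core.

  Lower bound for the hexagon: a saturated graph is connected, so it suffices to find two different
  cycles. If \<open>p0 p1 p2 p3\<close> is a path, then either \<open>p0 p3\<close> is an edge or saturation gives a path with
  five edges from \<open>p0\<close> to \<open>p3\<close>; combining the two paths yields a cycle with at most 8 vertices that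
  contains \<open>p0\<close> or misses one of \<open>p1\<close>, \<open>p3\<close>. Such a cycle \<open>C\<close> does not span the graph, so some
  \<open>x\<close> outside is adjacent to a vertex \<open>c0\<close> of \<open>C\<close>. For \<open>c0 c1 c2\<close> on \<open>C\<close>, the path \<open>x c0 c1 c2\<close>
  then gives a cycle that contains \<open>x\<close> or misses \<open>c0\<close> or \<open>c2\<close>, hence differs from \<open>C\<close>.\<close>

section \<open>Connectivity through cuts\<close>

definition crosses :: "'a set \<Rightarrow> 'a set \<Rightarrow> bool" where
  "crosses e S \<longleftrightarrow> e \<inter> S \<noteq> {} \<and> \<not> e \<subseteq> S"

definition connects :: "'a set \<Rightarrow> 'a set set \<Rightarrow> bool" where
  "connects V E \<longleftrightarrow> (\<forall>S. S \<subseteq> V \<longrightarrow> S \<noteq> {} \<longrightarrow> S \<noteq> V \<longrightarrow> (\<exists>e\<in>E. crosses e S))"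

text \<open>Every cut that meets \<open>Z\<close> meets it in two edges, so deleting one edge of \<open>Z\<close> from a graph
  preserves connectivity. This replaces spanning trees and the cyclomatic number below.\<close>

definition bridgeless :: "'a set set \<Rightarrow> bool" where
  "bridgeless Z \<longleftrightarrow> (\<forall>S. \<forall>e\<in>Z. crosses e S \<longrightarrow> (\<exists>g\<in>Z. g \<noteq> e \<and> crosses g S))"

lemma crosses_doubleton: "crosses {x, y} S \<longleftrightarrow> (x \<in> S) \<noteq> (y \<in> S)"
  by (auto simp: crosses_def)

text \<open>A set grown from one vertex along crossing edges gains one vertex and at least one
  induced edge per step, so a set of \<open>Suc n\<close> vertices induces at least \<open>n\<close>
  edges.\<close>

lemma card_verts_le_edges:
  assumes "finite V" "V \<noteq> {}" "E \<subseteq> Pow V" "\<forall>e\<in>E. card e = 2" "connects V E"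
  shows "card V \<le> card E + 1"
proof -
  have finE: "finite E"
    using assms(1,3) finite_subset by blast
  have "\<exists>S\<subseteq>V. card S = Suc n \<and> n \<le> card {e \<in> E. e \<subseteq> S}" if "n < card V" for n
    using that
  proof (induction n)
    case 0
    obtain v where "v \<in> V" using assms(2) by blast
    then show ?case by (intro exI[of _ "{v}"]) auto
  next
    case (Suc n)
    then obtain S where S: "S \<subseteq> V" "card S = Suc n" "n \<le> card {e \<in> E. e \<subseteq> S}"
      by auto
    then have "S \<noteq> {}" "S \<noteq> V"
      using Suc.prems by auto
    then obtain e where e: "e \<in> E" "crosses e S"
      using assms(5) S(1) unfolding connects_def by blast
    then obtain x y where xy: "x \<in> e" "x \<in> S" "y \<in> e" "y \<notin> S"
      unfolding crosses_def by blast
    have "card e = 2" using assms(4) e(1) by blast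
    then have exy: "e = {x, y}"
      using xy by (auto simp: card_2_iff)
    have finS: "finite S" using S(1) assms(1) finite_subset by blast
    have "Suc n \<le> card (insert e {e \<in> E. e \<subseteq> S})"
      using S(3) finE xy by (subst card_insert_disjoint) auto
    also have "\<dots> \<le> card {f \<in> E. f \<subseteq> insert y S}"
      using finE e exy xy by (intro card_mono) auto
    finally have "Suc n \<le> card {f \<in> E. f \<subseteq> insert y S}" .
    moreover have "insert y S \<subseteq> V" using S(1) e(1) assms(3) xy by auto
    moreover have "card (insert y S) = Suc (Suc n)" using finS xy S(2) by simp
    ultimately show ?case by blast
  qed
  from this[of "card V - 1"] obtain S where "card V - 1 \<le> card {e \<in> E. e \<subseteq> S}"
    using assms(1,2) by (auto simp: card_gt_0_iff)
  also have "\<dots> \<le> card E" using finE by (intro card_mono) auto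
  finally show ?thesis by simp
qed

lemma connects_remove:
  assumes "connects V E" "bridgeless Z" "Z \<subseteq> E" "f \<in> Z"
  shows "connects V (E - {f})"
  unfolding connects_def
proof (intro allI impI)
  fix S assume "S \<subseteq> V" "S \<noteq> {}" "S \<noteq> V"
  then obtain e where e: "e \<in> E" "crosses e S"
    using assms(1) unfolding connects_def by blast
  show "\<exists>e\<in>E - {f}. crosses e S"
  proof (cases "e = f")
    case True
    then obtain g where "g \<in> Z" "g \<noteq> f" "crosses g S"
      using assms(2,4) e unfolding bridgeless_def by blast
    then show ?thesis using assms(3) by blast
  qed (use e in blast)
qed

text \<open>An edge \<open>e\<close> in only one of the two sets can go first; the other set
  survives intact, so one of its edges can go too. The remaining \<open>card E - 2\<close> edges
  still connect \<open>V\<close>.\<close>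

lemma card_edges_of_two_bridgeless:
  assumes "finite V" "V \<noteq> {}" "E \<subseteq> Pow V" "\<forall>e\<in>E. card e = 2" "connects V E"
    and "bridgeless Z1" "Z1 \<subseteq> E" "Z1 \<noteq> {}" "bridgeless Z2" "Z2 \<subseteq> E" "Z2 \<noteq> {}" "Z1 \<noteq> Z2"
  shows "card V + 1 \<le> card E"
proof -
  \<comment> \<open>\<open>X\<close> is the set that owns \<open>e\<close>. Either \<open>Z1\<close>
    or \<open>Z2\<close> may take this role, as it is unknown on which side the two sets
    differ.\<close>
  have aux: "card V + 1 \<le> card E"
    if Z: "bridgeless X" "X \<subseteq> E" "bridgeless Y" "Y \<subseteq> E" "Y \<noteq> {}" "e \<in> X" "e \<notin> Y" for X Y e
  proof -
    obtain f where f: "f \<in> Y" using Z by blast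
    have "connects V (E - {e})"
      using connects_remove assms(5) Z by blast
    then have "connects V (E - {e} - {f})"
      using connects_remove[of V "E - {e}" Y f] Z f by blast
    then have "card V \<le> card (E - {e} - {f}) + 1"
      using assms(1-4) by (intro card_verts_le_edges) auto
    moreover have "card (E - {e} - {f}) + 2 = card E"
    proof -
      have fin: "finite E" using assms(1,3) finite_subset by blast
      have "e \<in> E" "f \<in> E - {e}" using Z f by auto
      then have "card E = Suc (card (E - {e}))" "card (E - {e}) = Suc (card (E - {e} - {f}))"
        using fin by (metis card.remove, metis card.remove finite_Diff)
      then show ?thesis by simp
    qed
    ultimately show ?thesis by simp
  qed
  from \<open>Z1 \<noteq> Z2\<close> obtain e where "e \<in> Z1 \<and> e \<notin> Z2 \<or> e \<in> Z2 \<and> e \<notin> Z1" by blast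
  then show ?thesis using aux assms(6-11) by blast
qed

section \<open>Cycles as lists\<close>

lemma Suc_mod_less: "i < n \<Longrightarrow> Suc i mod n < n"
  by (rule mod_less_divisor) simp

definition cycle_edge :: "'a list \<Rightarrow> nat \<Rightarrow> 'a set" where
  "cycle_edge xs i = {xs ! i, xs ! (Suc i mod length xs)}"

definition cycle_in :: "'a set set \<Rightarrow> 'a list \<Rightarrow> bool" where
  "cycle_in E xs \<longleftrightarrow> 3 \<le> length xs \<and> distinct xs \<and> (\<forall>i<length xs. cycle_edge xs i \<in> E)"

text \<open>Two indices could share an edge read in opposite directions only if each were the cyclic
  successor of the other, which length at least 3 excludes.\<close>

lemma cycle_edge_eq_iff:
  assumes "distinct xs" "3 \<le> length xs" "i < length xs" "j < length xs"
  shows "cycle_edge xs i = cycle_edge xs j \<longleftrightarrow> i = j"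
proof
  let ?n = "length xs"
  assume "cycle_edge xs i = cycle_edge xs j"
  then have "xs ! i = xs ! j \<or> xs ! i = xs ! (Suc j mod ?n) \<and> xs ! (Suc i mod ?n) = xs ! j"
    unfolding cycle_edge_def by (auto simp: doubleton_eq_iff)
  moreover have "Suc i mod ?n < ?n" "Suc j mod ?n < ?n" using assms by (simp_all add: Suc_mod_less)
  ultimately have "i = j \<or> i = Suc j mod ?n \<and> Suc i mod ?n = j"
    using assms by (auto simp: nth_eq_iff_index_eq)
  then show "i = j"
    using assms by (auto simp: mod_Suc split: if_splits)
qed simp

lemma cycle_edge_rotate:
  assumes "i < length xs"
  shows "cycle_edge (rotate m xs) i = cycle_edge xs ((m + i) mod length xs)"
proof -
  have "Suc i mod length xs < length xs" using assms by (rule Suc_mod_less)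
  then show ?thesis
    using assms by (simp add: cycle_edge_def nth_rotate mod_simps)
qed

lemma cycle_in_rotate:
  assumes "cycle_in E xs"
  shows "cycle_in E (rotate m xs)"
proof -
  have "cycle_edge (rotate m xs) i \<in> E" if "i < length xs" for i
  proof -
    have "(m + i) mod length xs < length xs" using that by (intro mod_less_divisor) auto
    then show ?thesis using assms that by (auto simp: cycle_in_def cycle_edge_rotate)
  qed
  then show ?thesis using assms by (auto simp: cycle_in_def)
qed

text \<open>Makes a chosen edge the closing edge of the list, so that the other edges form a path
  read from left to right.\<close>

lemma cycle_in_rotate_last:
  assumes "cycle_in E xs" "i < length xs"
  obtains ys where "cycle_in E ys" "length ys = length xs" "set ys = set xs"
    "cycle_edge ys (length ys - 1) = cycle_edge xs i" "ys = rotate (Suc i) xs"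
proof
  let ?ys = "rotate (Suc i) xs"
  show "cycle_in E ?ys" using assms(1) by (rule cycle_in_rotate)
  have "Suc i + (length xs - 1) = i + length xs"
    using assms(2) by simp
  then have "(Suc i + (length xs - 1)) mod length xs = i"
    using assms(2) by (simp only: mod_add_self2 mod_less)
  then show "cycle_edge ?ys (length ?ys - 1) = cycle_edge xs i"
    using assms(2) by (simp add: cycle_edge_rotate del: rotate_Suc)
qed auto

text \<open>Without \<open>e\<close> the cycle is a path between the ends of \<open>e\<close>. If no
  edge of this path crossed \<open>S\<close>, membership in \<open>S\<close> would be constant along
  it and \<open>e\<close> would not cross either.\<close>

lemma bridgeless_cycle:
  assumes "cycle_in E xs"
  shows "bridgeless (cycle_edge xs ` {..<length xs})"
  unfolding bridgeless_def
proof (intro allI ballI impI)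
  fix S e assume e: "e \<in> cycle_edge xs ` {..<length xs}" "crosses e S"
  then obtain i where "i < length xs" "e = cycle_edge xs i" by auto
  then obtain ys where ys: "cycle_in E ys" "length ys = length xs"
      "cycle_edge ys (length ys - 1) = e" and rot: "ys = rotate (Suc i) xs"
    using cycle_in_rotate_last[OF assms] by metis
  let ?n = "length ys"
  have n: "3 \<le> ?n" "distinct ys" using ys(1) by (auto simp: cycle_in_def)
  have "\<exists>k<?n - 1. crosses (cycle_edge ys k) S"
  proof (rule ccontr)
    assume *: "\<not> ?thesis"
    have "ys ! k \<in> S \<longleftrightarrow> ys ! 0 \<in> S" if "k < ?n" for k
      using that
    proof (induction k)
      case (Suc k)
      then have "\<not> crosses (cycle_edge ys k) S" using * by auto
      then show ?case
        using Suc by (auto simp: cycle_edge_def crosses_doubleton)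
    qed simp
    moreover have "Suc (?n - 1) mod ?n = 0" "?n - 1 < ?n" using n by (cases ?n; simp)+
    ultimately have "\<not> crosses e S"
      unfolding ys(3)[symmetric] cycle_edge_def crosses_doubleton by metis
    then show False using e by blast
  qed
  then obtain k where k: "k < ?n - 1" "crosses (cycle_edge ys k) S" by blast
  have "cycle_edge ys k \<noteq> e"
    using cycle_edge_eq_iff[of ys k "?n - 1"] n k unfolding ys(3)[symmetric] by auto
  moreover have "cycle_edge ys k \<in> cycle_edge xs ` {..<length xs}"
  proof -
    have "(Suc i + k) mod length xs < length xs" using n ys(2) by (intro mod_less_divisor) auto
    moreover have "cycle_edge ys k = cycle_edge xs ((Suc i + k) mod length xs)"
      unfolding rot using k ys(2) by (intro cycle_edge_rotate) auto
    ultimately show ?thesis by blast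
  qed
  ultimately show "\<exists>g\<in>cycle_edge xs ` {..<length xs}. g \<noteq> e \<and> crosses g S"
    using k by blast
qed

lemma Union_cycle_edges: "\<Union> (cycle_edge xs ` {..<length xs}) = set xs"
proof -
  have "Suc i mod length xs < length xs" if "i < length xs" for i using that by (rule Suc_mod_less)
  then show ?thesis by (auto simp: cycle_edge_def in_set_conv_nth) blast+
qed

text \<open>The edges of a cycle determine its vertices, so different vertex sets already force
  different edge sets.\<close>

lemma card_edges_of_two_cycles:
  assumes "finite V" "V \<noteq> {}" "E \<subseteq> Pow V" "\<forall>e\<in>E. card e = 2" "connects V E"
    and "cycle_in E xs" "cycle_in E ys" "set xs \<noteq> set ys"
  shows "card V + 1 \<le> card E"
proof (rule card_edges_of_two_bridgeless[OF assms(1-5)])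
  show "cycle_edge xs ` {..<length xs} \<noteq> cycle_edge ys ` {..<length ys}"
    using assms(8) Union_cycle_edges by metis
  show "bridgeless (cycle_edge xs ` {..<length xs})" "bridgeless (cycle_edge ys ` {..<length ys})"
    using assms(6,7) by (auto intro: bridgeless_cycle)
qed (use assms(6,7) in \<open>auto simp: cycle_in_def lessThan_empty_iff\<close>)

section \<open>Copies of cycles as lists, and the path left by a new edge\<close>

lemma contains_cycle_iff:
  assumes "3 \<le> r" "edges H \<subseteq> Pow (verts H)"
  shows "contains_copy H (cycle_graph r) \<longleftrightarrow> (\<exists>xs. cycle_in (edges H) xs \<and> length xs = r)"
proof
  assume "contains_copy H (cycle_graph r)"
  then obtain f where inj: "inj_on f {..<r}"
    and *: "\<forall>e\<in>{{i, Suc i mod r} | i. i < r}. f ` e \<in> edges H"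
    unfolding contains_copy_def cycle_graph_def ugraph.sel by (elim exE conjE) (rule that)
  have f: "f ` {i, Suc i mod r} \<in> edges H" if "i < r" for i
    by (rule *[rule_format]) (use that in blast)
  have "cycle_in (edges H) (map f [0..<r])"
    using f inj assms(1)
    by (simp add: cycle_in_def distinct_map cycle_edge_def atLeast0LessThan Suc_mod_less)
  then show "\<exists>xs. cycle_in (edges H) xs \<and> length xs = r"
    by (intro exI[of _ "map f [0..<r]"]) auto
next
  assume "\<exists>xs. cycle_in (edges H) xs \<and> length xs = r"
  then obtain xs where xs: "cycle_in (edges H) xs" "length xs = r" by blast
  have "inj_on ((!) xs) {..<r}"
    using xs by (auto simp: inj_on_def cycle_in_def nth_eq_iff_index_eq)
  moreover have "(!) xs ` {..<r} \<subseteq> verts H"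
    using xs assms(2) by (auto simp: cycle_in_def cycle_edge_def)
  ultimately show "contains_copy H (cycle_graph r)"
    using xs unfolding contains_copy_def cycle_graph_def
    by (intro exI[of _ "(!) xs"]) (auto simp: cycle_in_def cycle_edge_def)
qed

lemma cycle_in_4:
  "cycle_in E [a, b, c, d] \<longleftrightarrow> distinct [a, b, c, d] \<and>
     {a, b} \<in> E \<and> {b, c} \<in> E \<and> {c, d} \<in> E \<and> {d, a} \<in> E"
  by (simp add: cycle_in_def cycle_edge_def All_less_Suc2)

lemma cycle_in_6:
  "cycle_in E [a, b, c, d, e, f] \<longleftrightarrow> distinct [a, b, c, d, e, f] \<and>
     {a, b} \<in> E \<and> {b, c} \<in> E \<and> {c, d} \<in> E \<and> {d, e} \<in> E \<and> {e, f} \<in> E \<and> {f, a} \<in> E"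
  by (simp add: cycle_in_def cycle_edge_def All_less_Suc2)

lemma cycle_in_8:
  "cycle_in E [a, b, c, d, e, f, g, h] \<longleftrightarrow> distinct [a, b, c, d, e, f, g, h] \<and>
     {a, b} \<in> E \<and> {b, c} \<in> E \<and> {c, d} \<in> E \<and> {d, e} \<in> E \<and> {e, f} \<in> E \<and> {f, g} \<in> E \<and>
     {g, h} \<in> E \<and> {h, a} \<in> E"
  by (simp add: cycle_in_def cycle_edge_def All_less_Suc2)

text \<open>The hexagon must use the new edge. With that edge closing the list, the other five edges
  differ from it and lie in \<open>E\<close>; they are read backwards if the cycle traverses the new
  edge the other way.\<close>

lemma new_cycle_6_path:
  assumes "cycle_in (insert {a, b} E) xs" "\<not> cycle_in E xs" "length xs = 6"
  obtains q1 q2 q3 q4 where "distinct [a, q1, q2, q3, q4, b]"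
    "{a, q1} \<in> E" "{q1, q2} \<in> E" "{q2, q3} \<in> E" "{q3, q4} \<in> E" "{q4, b} \<in> E"
proof -
  obtain i where i: "i < length xs" "cycle_edge xs i = {a, b}"
    using assms(1,2) unfolding cycle_in_def by blast
  obtain ys where ys: "cycle_in (insert {a, b} E) ys" "length ys = 6"
      "cycle_edge ys (length ys - 1) = {a, b}"
    using cycle_in_rotate_last[OF assms(1) i(1)] i(2) assms(3) by metis
  have E: "cycle_edge ys k \<in> E" if "k < 5" for k
  proof -
    have "cycle_edge ys k \<noteq> cycle_edge ys (length ys - 1)"
      using ys that by (subst cycle_edge_eq_iff) (auto simp: cycle_in_def)
    moreover have "cycle_edge ys k \<in> insert {a, b} E"
      using ys(1,2) that by (simp add: cycle_in_def)
    ultimately show ?thesis using ys(3) by simp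
  qed
  obtain y0 y1 y2 y3 y4 y5 where y: "ys = [y0, y1, y2, y3, y4, y5]"
    using ys(2) by (auto simp: length_Suc_conv eval_nat_numeral)
  have d: "distinct ys" using ys(1) by (simp add: cycle_in_def)
  have e: "{y0, y1} \<in> E" "{y1, y2} \<in> E" "{y2, y3} \<in> E" "{y3, y4} \<in> E" "{y4, y5} \<in> E"
    using E[of 0] E[of 1] E[of 2] E[of 3] E[of 4] by (simp_all add: y cycle_edge_def)
  have "{y5, y0} = {a, b}" using ys(3) by (simp add: y cycle_edge_def)
  then consider "y5 = b" "y0 = a" | "y5 = a" "y0 = b" by (auto simp: doubleton_eq_iff)
  then show ?thesis
  proof cases
    case 1
    show ?thesis by (rule that[of y1 y2 y3 y4]) (use 1 d e in \<open>auto simp: y\<close>)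
  next
    case 2
    show ?thesis by (rule that[of y4 y3 y2 y1]) (use 2 d e in \<open>auto simp: y insert_commute\<close>)
  qed
qed

section \<open>The lower bound for the hexagon\<close>

text \<open>\<open>col\<close> is the bipartition, and \<open>sat\<close> is saturation in path
  form: the hexagon closed by a missing edge leaves a path with five edges between its ends.\<close>

lemma path3_cycle:
  assumes bip: "\<And>x y. {x, y} \<in> E \<Longrightarrow> col x \<noteq> (col y :: bool)"
    and no6: "\<And>xs. cycle_in E xs \<Longrightarrow> length xs \<noteq> 6"
    and sat: "\<And>x y. x \<in> V \<Longrightarrow> y \<in> V \<Longrightarrow> col x \<noteq> col y \<Longrightarrow> {x, y} \<notin> E \<Longrightarrow>
      \<exists>q1 q2 q3 q4. distinct [x, q1, q2, q3, q4, y] \<and> {x, q1} \<in> E \<and> {q1, q2} \<in> E \<and>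
        {q2, q3} \<in> E \<and> {q3, q4} \<in> E \<and> {q4, y} \<in> E"
    and V: "p0 \<in> V" "p3 \<in> V"
    and P: "distinct [p0, p1, p2, p3]" "{p0, p1} \<in> E" "{p1, p2} \<in> E" "{p2, p3} \<in> E"
  shows "\<exists>xs. cycle_in E xs \<and> length xs \<le> 8 \<and> (p0 \<in> set xs \<or> p1 \<notin> set xs \<or> p3 \<notin> set xs)"
    (is "\<exists>xs. ?Q xs")
proof (cases "{p0, p3} \<in> E")
  case True
  then have "?Q [p0, p1, p2, p3]" using P by (auto simp: cycle_in_4 insert_commute)
  then show ?thesis by blast
next
  case False
  have col: "col p1 = (\<not> col p0)" "col p2 = col p0" "col p3 = (\<not> col p0)"
    using bip[OF P(2)] bip[OF P(3)] bip[OF P(4)] by auto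
  obtain q1 q2 q3 q4 where q: "distinct [p0, q1, q2, q3, q4, p3]" "{p0, q1} \<in> E" "{q1, q2} \<in> E"
      "{q2, q3} \<in> E" "{q3, q4} \<in> E" "{q4, p3} \<in> E"
    using sat[OF V _ False] col by auto
  have colq: "col q1 = (\<not> col p0)" "col q2 = col p0" "col q3 = (\<not> col p0)" "col q4 = col p0"
    using bip[OF q(2)] bip[OF q(3)] bip[OF q(4)] bip[OF q(5)] by auto
  have ne: "p1 \<noteq> q2" "p1 \<noteq> q4" "p2 \<noteq> q1" "p2 \<noteq> q3" using col colq by auto
  note facts = P q ne
  have no: "\<not> cycle_in E [a, b, c, d, e, f]" for a b c d e f using no6 by fastforce
  \<comment> \<open>The colours allow only \<open>p1\<close> in {\<open>q1\<close>,
    \<open>q3\<close>} and \<open>p2\<close> in {\<open>q2\<close>, \<open>q4\<close>} as common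
    inner vertices. Cases d, e and g give a forbidden hexagon; b gives a 4-cycle missing
    \<open>p3\<close>, c one missing \<open>p1\<close>, and a, f, h give cycles through
    \<open>p0\<close>.\<close>
  consider (a) "p1 \<noteq> q1" "p1 \<noteq> q3" "p2 \<noteq> q2" "p2 \<noteq> q4"
    | (b) "p1 = q1" "p2 = q4" | (c) "p1 = q1" "p2 = q2" | (d) "p1 = q1" "p2 \<noteq> q2" "p2 \<noteq> q4"
    | (e) "p1 = q3" "p2 = q2" | (f) "p1 = q3" "p2 \<noteq> q2"
    | (g) "p1 \<noteq> q1" "p1 \<noteq> q3" "p2 = q4" | (h) "p1 \<noteq> q1" "p1 \<noteq> q3" "p2 = q2"
    by blast
  then show ?thesis
  proof cases
    case a
    then have "?Q [p0, q1, q2, q3, q4, p3, p2, p1]"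
      using facts by (auto simp: cycle_in_8 insert_commute)
    then show ?thesis by blast
  next
    case b
    then have "?Q [q1, q2, q3, q4]"
      using facts by (auto simp: cycle_in_4 insert_commute)
    then show ?thesis by blast
  next
    case c
    then have "?Q [q2, q3, q4, p3]"
      using facts by (auto simp: cycle_in_4 insert_commute)
    then show ?thesis by blast
  next
    case d
    then have "cycle_in E [p1, q2, q3, q4, p3, p2]"
      using facts by (auto simp: cycle_in_6 insert_commute)
    then show ?thesis using no by blast
  next
    case e
    then have "cycle_in E [p0, q1, p2, p3, q4, p1]"
      using facts by (auto simp: cycle_in_6 insert_commute)
    then show ?thesis using no by blast
  next
    case f
    then have "?Q [p0, q1, q2, q3]"
      using facts by (auto simp: cycle_in_4 insert_commute)
    then show ?thesis by blast
  next
    case g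
    then have "cycle_in E [p0, q1, q2, q3, q4, p1]"
      using facts by (auto simp: cycle_in_6 insert_commute)
    then show ?thesis using no by blast
  next
    case h
    then have "?Q [p0, q1, q2, p1]"
      using facts by (auto simp: cycle_in_4 insert_commute)
    then show ?thesis by blast
  qed
qed

lemma crossing_edge_of_5path:
  assumes "{a, q1} \<in> E" "{q1, q2} \<in> E" "{q2, q3} \<in> E" "{q3, q4} \<in> E" "{q4, b} \<in> E"
    and "a \<in> S \<longleftrightarrow> b \<notin> S"
  shows "\<exists>e\<in>E. crosses e S"
  using assms crosses_doubleton by metis

lemma sat_hexagon_lower_bound:
  fixes V :: "'a set"
  assumes V: "finite V" "8 < card V" "E \<subseteq> Pow V" "\<forall>e\<in>E. card e = 2"
    and two: "\<exists>x\<in>V. \<exists>x'\<in>V. x \<noteq> x' \<and> col x \<and> col x'" "\<exists>y\<in>V. \<exists>y'\<in>V. y \<noteq> y' \<and> \<not> col y \<and> \<not> col y'"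
    and bip: "\<And>x y. {x, y} \<in> E \<Longrightarrow> col x \<noteq> (col y :: bool)"
    and no6: "\<And>xs. cycle_in E xs \<Longrightarrow> length xs \<noteq> 6"
    and sat: "\<And>x y. x \<in> V \<Longrightarrow> y \<in> V \<Longrightarrow> col x \<noteq> col y \<Longrightarrow> {x, y} \<notin> E \<Longrightarrow>
      \<exists>q1 q2 q3 q4. distinct [x, q1, q2, q3, q4, y] \<and> {x, q1} \<in> E \<and> {q1, q2} \<in> E \<and>
        {q2, q3} \<in> E \<and> {q3, q4} \<in> E \<and> {q4, y} \<in> E"
  shows "card V + 1 \<le> card E"
proof -
  have cross: "\<exists>e\<in>E. crosses e S" if "a \<in> V" "b \<in> V" "col a \<noteq> col b" "a \<in> S \<longleftrightarrow> b \<notin> S" for a b S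
  proof (cases "{a, b} \<in> E")
    case True
    then show ?thesis using that crosses_doubleton by metis
  next
    case False
    from sat[OF that(1-3) this] obtain q1 q2 q3 q4 where
      "{a, q1} \<in> E" "{q1, q2} \<in> E" "{q2, q3} \<in> E" "{q3, q4} \<in> E" "{q4, b} \<in> E"
      by (elim exE conjE) (rule that)
    then show ?thesis using that(4) by (rule crossing_edge_of_5path)
  qed
  have cyc: "\<exists>xs. cycle_in E xs \<and> length xs \<le> 8 \<and> (a \<in> set xs \<or> b \<notin> set xs \<or> d \<notin> set xs)"
    if "a \<in> V" "d \<in> V" "distinct [a, b, c, d]" "{a, b} \<in> E" "{b, c} \<in> E" "{c, d} \<in> E" for a b c d
    by (rule path3_cycle[where col = col and V = V, OF _ _ _ that]) (fact bip no6 sat)+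
  have conn: "connects V E"
    unfolding connects_def
  proof (intro allI impI)
    fix S assume S: "S \<subseteq> V" "S \<noteq> {}" "S \<noteq> V"
    then obtain s t where st: "s \<in> S" "t \<in> V" "t \<notin> S" "s \<in> V" by blast
    show "\<exists>e\<in>E. crosses e S"
    proof (cases "col s = col t")
      case True
      \<comment> \<open>Whichever side of the cut \<open>u\<close> lies on, it is separated from
        \<open>s\<close> or from \<open>t\<close>, and it has the opposite colour to both.\<close>
      obtain u where "u \<in> V" "col u \<noteq> col s"
        using two by metis
      then show ?thesis using cross[of s u] cross[of t u] st True by auto
    qed (use st cross in blast)
  qed
  have "\<exists>p0 p1 p2 p3. distinct [p0, p1, p2, p3] \<and> {p0, p1} \<in> E \<and> {p1, p2} \<in> E \<and> {p2, p3} \<in> E"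
  proof -
    obtain x x' y y' where xy: "x \<in> V" "x' \<in> V" "y \<in> V" "y' \<in> V" "x \<noteq> x'" "y \<noteq> y'"
      "col x" "col x'" "\<not> col y" "\<not> col y'" using two by blast
    show ?thesis
    \<comment> \<open>Either \<open>x y x' y'\<close> is itself the desired path, or one of its
      edges is missing and saturation supplies a longer path, whose first four vertices
      serve.\<close>
    proof (cases "{x, y} \<in> E \<and> {y, x'} \<in> E \<and> {x', y'} \<in> E")
      case True
      then show ?thesis using xy by (intro exI[of _ x] exI[of _ y] exI[of _ x'] exI[of _ y']) auto
    next
      case False
      then obtain u v where "u \<in> V" "v \<in> V" "col u \<noteq> col v" "{u, v} \<notin> E" using xy by blast
      from sat[OF this] obtain q1 q2 q3 q4 where
        "distinct [u, q1, q2, q3, q4, v] \<and> {u, q1} \<in> E \<and> {q1, q2} \<in> E \<and>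
        {q2, q3} \<in> E \<and> {q3, q4} \<in> E \<and> {q4, v} \<in> E" by blast
      then show ?thesis by (intro exI[of _ u] exI[of _ q1] exI[of _ q2] exI[of _ q3]) auto
    qed
  qed
  then obtain p0 p1 p2 p3 where p: "distinct [p0, p1, p2, p3]" "{p0, p1} \<in> E" "{p1, p2} \<in> E"
    "{p2, p3} \<in> E" by blast
  have "p0 \<in> V" "p3 \<in> V" using p V(3) by auto
  from cyc[OF this p] obtain c where c: "cycle_in E c" "length c \<le> 8" by blast
  have cV: "set c \<subseteq> V"
    using c(1) V(3) unfolding Union_cycle_edges[symmetric] cycle_in_def by blast
  have "set c \<noteq> V" using c(2) V(2) card_length[of c] by auto
  moreover have "set c \<noteq> {}" using c(1) by (auto simp: cycle_in_def)
  ultimately obtain e where e: "e \<in> E" "crosses e (set c)"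
    using conn cV unfolding connects_def by blast
  then obtain z x where z: "z \<in> e" "z \<in> set c" "x \<in> e" "x \<notin> set c"
    unfolding crosses_def by blast
  have "card e = 2" using V(4) e(1) by blast
  then have exz: "e = {x, z}" using z by (auto simp: card_2_iff)
  obtain i where i: "i < length c" "c ! i = z" using z by (auto simp: in_set_conv_nth)
  \<comment> \<open>The rotation puts the attachment vertex \<open>z\<close> first, so that
    \<open>x\<close> followed by the first three entries of \<open>d\<close> is a path.\<close>
  define d where "d = rotate i c"
  have d: "cycle_in E d" "set d = set c" "length d = length c"
    using cycle_in_rotate[OF c(1)] by (auto simp: d_def)
  have d0: "d ! 0 = z"
    using nth_rotate[of 0 c i] i by (cases c) (auto simp: d_def)
  obtain c0 c1 c2 r where dl: "d = c0 # c1 # c2 # r"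
    using d(1) by (auto simp: cycle_in_def numeral_3_eq_3 Suc_le_length_iff)
  have "0 < length d" "1 < length d" by (simp_all add: dl)
  then have "cycle_edge d 0 \<in> E" "cycle_edge d 1 \<in> E"
    using d(1) unfolding cycle_in_def by blast+
  then have ce: "{c0, c1} \<in> E" "{c1, c2} \<in> E" by (auto simp: dl cycle_edge_def)
  have xE: "{x, c0} \<in> E" using e exz d0 dl by auto
  have xd: "x \<notin> set d" using z d by auto
  have dist: "distinct [x, c0, c1, c2]" using d(1) xd by (auto simp: dl cycle_in_def)
  have "x \<in> V" "c2 \<in> V" using xE ce V(3) by auto
  from cyc[OF this dist xE ce] obtain xs where
    xs: "cycle_in E xs" "x \<in> set xs \<or> c0 \<notin> set xs \<or> c2 \<notin> set xs" by blast
  have "set xs \<noteq> set d" using xs(2) xd by (auto simp: dl)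
  moreover have "V \<noteq> {}" using V(2) by auto
  ultimately show ?thesis
    using card_edges_of_two_cycles[OF V(1) _ V(3,4) conn xs(1) d(1)] by blast
qed

lemma saturated_hexagon_card:
  assumes n: "5 \<le> n1" "5 \<le> n2"
    and sat: "saturated_in (complete_bipartite n1 n2) (cycle_graph 6) H"
  shows "n1 + n2 + 1 \<le> card (edges H)"
proof -
  let ?G = "complete_bipartite n1 n2"
  have H: "verts H = verts ?G" "edges H \<subseteq> edges ?G"
    "\<not> contains_copy H (cycle_graph 6)"
    "\<And>e. e \<in> edges ?G - edges H \<Longrightarrow> contains_copy (add_edge H e) (cycle_graph 6)"
    using sat by (auto simp: saturated_in_def spanning_subgraph_def)
  have G: "edges ?G \<subseteq> Pow (verts ?G)" "\<forall>e\<in>edges ?G. card e = 2" "finite (verts ?G)"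
    using simple_graph_complete_bipartite[of n1 n2] by (auto simp: simple_graph_def)
  have cV: "card (verts ?G) = n1 + n2"
    by (simp add: complete_bipartite_def card_Plus)
  have no6: "length xs \<noteq> 6" if "cycle_in (edges H) xs" for xs
    using contains_cycle_iff[of 6 H] H that G by auto
  have Vin: "Inl i \<in> verts ?G \<longleftrightarrow> i < n1" "Inr j \<in> verts ?G \<longleftrightarrow> j < n2" for i j
    by (auto simp: complete_bipartite_def)
  have path: "\<exists>q1 q2 q3 q4. distinct [x, q1, q2, q3, q4, y] \<and> {x, q1} \<in> edges H \<and>
      {q1, q2} \<in> edges H \<and> {q2, q3} \<in> edges H \<and> {q3, q4} \<in> edges H \<and> {q4, y} \<in> edges H"
    if "x \<in> verts ?G" "y \<in> verts ?G" "isl x \<noteq> isl y" "{x, y} \<notin> edges H" for x y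
  proof -
    have "{x, y} \<in> edges ?G"
      using that(1-3) by (cases x; cases y) (auto simp: complete_bipartite_def insert_commute)
    then have "contains_copy (add_edge H {x, y}) (cycle_graph 6)"
      using H(4) that(4) by blast
    moreover have "edges (add_edge H {x, y}) \<subseteq> Pow (verts (add_edge H {x, y}))"
      using that H(1,2) G(1) by (auto simp: add_edge_def)
    ultimately obtain xs where xs: "cycle_in (insert {x, y} (edges H)) xs" "length xs = 6"
      by (auto simp: contains_cycle_iff) (auto simp: add_edge_def)
    have "\<not> cycle_in (edges H) xs" using no6 xs(2) by blast
    from new_cycle_6_path[OF xs(1) this xs(2)] show ?thesis by metis
  qed
  have "card (verts ?G) + 1 \<le> card (edges H)"
  proof (rule sat_hexagon_lower_bound[where col = isl])
    show "\<exists>x\<in>verts ?G. \<exists>x'\<in>verts ?G. x \<noteq> x' \<and> isl x \<and> isl x'"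
      using n Vin(1)[of 0] Vin(1)[of 1]
      by (intro bexI[of _ "Inl 0"] bexI[of _ "Inl 1"]) auto
    show "\<exists>y\<in>verts ?G. \<exists>y'\<in>verts ?G. y \<noteq> y' \<and> \<not> isl y \<and> \<not> isl y'"
      using n Vin(2)[of 0] Vin(2)[of 1]
      by (intro bexI[of _ "Inr 0"] bexI[of _ "Inr 1"]) auto
    show "isl x \<noteq> isl y" if "{x, y} \<in> edges H" for x y
    proof -
      have "{x, y} \<in> edges ?G" using that H(2) by blast
      then obtain i j where "{x, y} = {Inl i, Inr j}"
        unfolding complete_bipartite_def ugraph.sel by blast
      then show ?thesis by (auto simp: doubleton_eq_iff)
    qed
  qed (use n G H cV no6 path in auto)
  then show ?thesis using cV by simp
qed

section \<open>The upper bound\<close>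

text \<open>The left vertices \<open>i < l\<close> and the right vertices \<open>j < l - 1\<close> form the core, and the right
  vertex \<open>l - 1\<close> is \<open>v\<close>, joined to the core at the left vertex \<open>0\<close>.\<close>

definition sat_adj :: "nat \<Rightarrow> nat \<Rightarrow> nat \<Rightarrow> bool" where
  "sat_adj l i j \<longleftrightarrow> i < l \<and> j < l - 1 \<or> (i = 0 \<or> l \<le> i) \<and> j = l - 1 \<or> i = 1 \<and> l \<le> j"

definition sat_graph :: "nat \<Rightarrow> nat \<Rightarrow> nat \<Rightarrow> (nat + nat) ugraph" where
  "sat_graph l m n = Graph ({..<m} <+> {..<n}) {{Inl i, Inr j} | i j. i < m \<and> j < n \<and> sat_adj l i j}"

lemma edge_sat_graph:
  "{Inl i, Inr j} \<in> edges (sat_graph l m n) \<longleftrightarrow> i < m \<and> j < n \<and> sat_adj l i j"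
  by (auto simp: sat_graph_def doubleton_eq_iff)

lemma edges_sat_graph_subset: "edges (sat_graph l m n) \<subseteq> Pow (verts (sat_graph l m n))"
  by (auto simp: sat_graph_def)

text \<open>\<open>?A\<close> is the core, \<open>?B\<close> the star at \<open>v\<close> including
  its edge to the core, and \<open>?C\<close> the pendant right vertices.\<close>

lemma card_edges_sat_graph:
  assumes "3 \<le> l" "l \<le> m" "l \<le> n"
  shows "card (edges (sat_graph l m n)) = l * (l - 1) + 1 + (m - l) + (n - l)"
proof -
  let ?A = "{..<l} \<times> {..<l - 1}" and ?B = "insert 0 {l..<m} \<times> {l - 1}" and ?C = "{1} \<times> {l..<n}"
  have eq: "edges (sat_graph l m n) = (\<lambda>(i, j). {Inl i, Inr j}) ` (?A \<union> (?B \<union> ?C))"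
    using assms unfolding sat_graph_def sat_adj_def by (fastforce simp: image_iff)
  have "inj_on (\<lambda>(i, j). {Inl i, Inr j}) (?A \<union> (?B \<union> ?C))"
    by (auto simp: inj_on_def doubleton_eq_iff)
  then have "card (edges (sat_graph l m n)) = card (?A \<union> (?B \<union> ?C))"
    unfolding eq by (rule card_image)
  also have "\<dots> = card ?A + (card ?B + card ?C)"
    using assms by (subst card_Un_disjoint; (subst card_Un_disjoint)?) auto
  also have "card ?A = l * (l - 1)" by simp
  also have "card ?B = 1 + (m - l)"
    using assms by (subst card_cartesian_product) simp
  also have "card ?C = n - l" by (simp add: card_cartesian_product)
  finally show ?thesis by simp
qed

section \<open>The construction contains no 2l-cycle\<close>

lemma cycle_in_neighbours:
  assumes "cycle_in E xs" "x \<in> set xs"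
  obtains y z where "y \<in> set xs" "z \<in> set xs" "y \<noteq> z" "{x, y} \<in> E" "{x, z} \<in> E"
proof -
  obtain i where i: "i < length xs" "xs ! i = x" using assms(2) by (auto simp: in_set_conv_nth)
  define d where "d = rotate i xs"
  have d: "cycle_in E d" "set d = set xs" "length d = length xs"
    using cycle_in_rotate[OF assms(1)] by (auto simp: d_def)
  have d0: "d ! 0 = x" using nth_rotate[of 0 xs i] i by (cases xs) (auto simp: d_def)
  have n: "3 \<le> length d" "distinct d" using d(1) by (auto simp: cycle_in_def)
  have "0 < length d" "length d - 1 < length d" using n(1) by linarith+
  then have "cycle_edge d 0 \<in> E" "cycle_edge d (length d - 1) \<in> E"
    using d(1) unfolding cycle_in_def by blast+
  moreover have "Suc 0 mod length d = 1" "Suc (length d - 1) mod length d = 0"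
    using n(1) by (cases "length d"; simp)+
  ultimately have "{x, d ! 1} \<in> E" "{x, d ! (length d - 1)} \<in> E"
    unfolding cycle_edge_def d0 by (simp_all only: d0 insert_commute)
  moreover have "d ! 1 \<noteq> d ! (length d - 1)" using n by (auto simp: nth_eq_iff_index_eq)
  moreover have "d ! 1 \<in> set xs" "d ! (length d - 1) \<in> set xs" using n d(2) by (auto intro!: nth_mem simp flip: d(2))
  ultimately show ?thesis using that by blast
qed

text \<open>Every vertex of a cycle has two neighbours on it, so vertices outside the core are
  peeled off until only the \<open>2 * l - 1\<close> core vertices remain, too few for the
  cycle.\<close>

lemma sat_graph_no_cycle:
  assumes "3 \<le> l"
  shows "\<not> contains_copy (sat_graph l m n) (cycle_graph (2 * l))"
proof
  let ?E = "edges (sat_graph l m n)"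
  assume "contains_copy (sat_graph l m n) (cycle_graph (2 * l))"
  then obtain xs where xs: "cycle_in ?E xs" "length xs = 2 * l"
    using contains_cycle_iff[OF _ edges_sat_graph_subset, of "2 * l"] assms by auto
  have sub: "e \<in> ?E \<Longrightarrow> \<exists>i j. e = {Inl i, Inr j} \<and> sat_adj l i j" for e
    by (auto simp: sat_graph_def)
  have L: "\<exists>j j'. j \<noteq> j' \<and> Inr j \<in> set xs \<and> Inr j' \<in> set xs \<and> sat_adj l i j \<and> sat_adj l i j'"
    if i: "Inl i \<in> set xs" for i
  proof -
    obtain y z where "y \<in> set xs" "z \<in> set xs" "y \<noteq> z" "{Inl i, y} \<in> ?E" "{Inl i, z} \<in> ?E"
      by (rule cycle_in_neighbours[OF xs(1) i])
    then show ?thesis using sub[of "{Inl i, y}"] sub[of "{Inl i, z}"]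
      by (auto simp: doubleton_eq_iff)
  qed
  have R: "\<exists>i i'. i \<noteq> i' \<and> Inl i \<in> set xs \<and> Inl i' \<in> set xs \<and> sat_adj l i j \<and> sat_adj l i' j"
    if j: "Inr j \<in> set xs" for j
  proof -
    obtain y z where "y \<in> set xs" "z \<in> set xs" "y \<noteq> z" "{Inr j, y} \<in> ?E" "{Inr j, z} \<in> ?E"
      by (rule cycle_in_neighbours[OF xs(1) j])
    then show ?thesis using sub[of "{Inr j, y}"] sub[of "{Inr j, z}"]
      by (auto simp: doubleton_eq_iff)
  qed
  have left: "i < l" if "Inl i \<in> set xs" for i
    using L[OF that] assms by (auto simp: sat_adj_def)
  \<comment> \<open>The order of peeling matters: \<open>v\<close> may have many pendant left
    neighbours, and only once these are excluded by \<open>left\<close> is \<open>0\<close> its sole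
    possible neighbour on the cycle.\<close>
  have "j < l - 1" if j: "Inr j \<in> set xs" for j
  proof -
    from R[OF j] obtain i i' where i: "i \<noteq> i'" "i < l" "i' < l" "sat_adj l i j" "sat_adj l i' j"
      using left by blast
    then show ?thesis using assms by (auto simp: sat_adj_def)
  qed
  with left have "set xs \<subseteq> {..<l} <+> {..<l - 1}"
    by (metis InlI InrI lessThan_iff subsetI sumE)
  then have "card (set xs) \<le> l + (l - 1)"
    using card_mono[of "{..<l} <+> {..<l - 1}" "set xs"] by (simp add: card_Plus)
  moreover have "card (set xs) = 2 * l"
    using xs by (simp add: cycle_in_def distinct_card)
  ultimately show False using assms by simp
qed

section \<open>Every missing edge closes a 2l-cycle\<close>

lemma contains_alternating_cycle:
  fixes a b :: "nat \<Rightarrow> nat"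
  assumes "3 \<le> l" "inj_on a {..<l}" "inj_on b {..<l}" "edges H \<subseteq> Pow (verts H)"
    and "\<And>k. k < l \<Longrightarrow> {Inl (a k), Inr (b k)} \<in> edges H"
    and "\<And>k. k < l \<Longrightarrow> {Inl (a (Suc k mod l)), Inr (b k)} \<in> edges H"
  shows "contains_copy H (cycle_graph (2 * l))"
proof -
  \<comment> \<open>The cycle runs \<open>a 0\<close>, \<open>b 0\<close>, \<open>a 1\<close>,
    \<open>b 1\<close>, and so on, with \<open>b (l - 1)\<close> leading back to
    \<open>a 0\<close>.\<close>
  define f where "f i = (if even i then Inl (a (i div 2)) else Inr (b (i div 2)))" for i
  have "inj_on f {..<2 * l}"
  proof (rule inj_onI)
    fix i j assume ij: "i \<in> {..<2 * l}" "j \<in> {..<2 * l}" "f i = f j"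
    then have "i div 2 < l" "j div 2 < l" by auto
    then have "i div 2 = j div 2" "even i = even j"
      using ij(3) assms(2,3) by (auto simp: f_def inj_on_def split: if_splits)
    then show "i = j" by (metis bit_eq_rec)
  qed
  moreover have edge: "f ` {i, Suc i mod (2 * l)} \<in> edges H" if "i < 2 * l" for i
  proof (cases "even i")
    case True
    then obtain k where k: "i = 2 * k" by blast
    then have "Suc i mod (2 * l) = Suc (2 * k)" using that by auto
    then show ?thesis using assms(5)[of k] k that by (simp add: f_def insert_commute)
  next
    case False
    then obtain k where k: "i = Suc (2 * k)" by (auto elim: oddE)
    have "Suc i mod (2 * l) = 2 * (Suc k mod l)"
      unfolding k by (metis add_2_eq_Suc' mult_Suc_right add.commute mult_mod_right)
    then show ?thesis using assms(6)[of k] k that by (simp add: f_def insert_commute)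
  qed
  moreover have "f ` {..<2 * l} \<subseteq> verts H"
    using edge assms(4) by fastforce
  ultimately show ?thesis
    unfolding contains_copy_def cycle_graph_def by (intro exI[of _ f]) auto
qed

text \<open>The core is complete bipartite, so any ordering of its left vertices extends to a path
  through the whole core; this fixes the two ends.\<close>

lemma permutation_with_ends:
  fixes x i l :: nat
  assumes "x \<noteq> i" "x < l" "i < l" "2 \<le> l"
  obtains a where "inj_on a {..<l}" "\<And>k. k < l \<Longrightarrow> a k < l" "a 0 = x" "a (l - 1) = i"
proof
  let ?s = "transpose 0 x"
  \<comment> \<open>The inner transposition sends \<open>0\<close> to \<open>x\<close>. The outer
    one moves the image of \<open>l - 1\<close> to \<open>i\<close> and fixes \<open>x\<close>,
    which differs from both points swapped.\<close>
  let ?a = "transpose i (?s (l - 1)) \<circ> ?s"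
  have "inj ?a" by (intro inj_compose) auto
  then show "inj_on ?a {..<l}" by (rule inj_on_subset) auto
  show "?a k < l" if "k < l" for k
    using that assms by (auto simp: transpose_def)
  show "?a 0 = x" using assms by (auto simp: transpose_def)
  show "?a (l - 1) = i" by simp
qed

lemma sat_graph_saturated_aux:
  assumes l: "3 \<le> l" "l \<le> m" "l \<le> n" and ij: "i < m" "j < n" "\<not> sat_adj l i j"
  shows "contains_copy (add_edge (sat_graph l m n) {Inl i, Inr j}) (cycle_graph (2 * l))"
    (is "contains_copy ?H _")
proof -
  have sub: "edges ?H \<subseteq> Pow (verts ?H)"
    using ij edges_sat_graph_subset[of l m n] by (auto simp: add_edge_def sat_graph_def)
  have E: "{Inl x, Inr y} \<in> edges ?H \<longleftrightarrow> x = i \<and> y = j \<or> x < m \<and> y < n \<and> sat_adj l x y" for x y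
    using edge_sat_graph[of x y l m n] by (auto simp: add_edge_def doubleton_eq_iff)
  have cyc: ?thesis
    if "inj_on a {..<l}" "inj_on b {..<l}"
      "\<And>k. k < l \<Longrightarrow> a k = i \<and> b k = j \<or> a k < m \<and> b k < n \<and> sat_adj l (a k) (b k)"
      "\<And>k. k < l \<Longrightarrow> a (Suc k mod l) = i \<and> b k = j \<or>
        a (Suc k mod l) < m \<and> b k < n \<and> sat_adj l (a (Suc k mod l)) (b k)" for a b
    using contains_alternating_cycle[OF l(1) that(1,2) sub] that(3,4) unfolding E by blast
  have core_adj: "x < m \<and> y < n \<and> sat_adj l x y" if "x < l" "y < l - 1" for x y
    using that l by (simp add: sat_adj_def)
  have last: "Suc k mod l = (if k = l - 1 then 0 else Suc k)" if "k < l" for k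
    using that by auto
  consider (core) x where "i < l" "l - 1 \<le> j" "x \<noteq> i" "x < l" "sat_adj l x j"
    | (pendant_core) "l \<le> i" "j < l - 1" | (pendants) "l \<le> i" "l \<le> j"
  proof (cases "i < l")
    case True
    \<comment> \<open>\<open>x\<close> is the only core neighbour of \<open>j\<close>:
      \<open>0\<close> if \<open>j\<close> is \<open>v\<close>, and \<open>1\<close> if
      \<open>j\<close> is a pendant right vertex.\<close>
    define x where "x = (if j = l - 1 then 0 else 1 :: nat)"
    have "l - 1 \<le> j" using ij True by (simp add: sat_adj_def)
    moreover from this have "x \<noteq> i" "x < l" "sat_adj l x j"
      using ij l by (auto simp: sat_adj_def x_def)
    ultimately show thesis using that(1) True by blast
  next
    case False
    then have "j \<noteq> l - 1" using ij by (simp add: sat_adj_def)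
    then show thesis using that(2,3) False by linarith
  qed
  then show ?thesis
  proof cases
    case core
    \<comment> \<open>A Hamiltonian path of the core from \<open>x\<close> to \<open>i\<close> is
      closed through \<open>j\<close>, by the new edge and the edge from \<open>j\<close> to
      \<open>x\<close>.\<close>
    obtain a where a: "inj_on a {..<l}" "\<And>k. k < l \<Longrightarrow> a k < l" "a 0 = x" "a (l - 1) = i"
      using permutation_with_ends[OF core(3,4,1)] l by auto
    show ?thesis
    proof (rule cyc[of a "\<lambda>k. if k = l - 1 then j else k"])
      show "inj_on (\<lambda>k. if k = l - 1 then j else k) {..<l}"
        using core by (auto simp: inj_on_def)
    next
      fix k assume k: "k < l"
      then show "a k = i \<and> (if k = l - 1 then j else k) = j \<or> a k < m \<and>
          (if k = l - 1 then j else k) < n \<and> sat_adj l (a k) (if k = l - 1 then j else k)"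
        using a(2)[OF k] a(4) l by (auto simp: sat_adj_def)
      have "Suc k mod l < l" using l by auto
      from a(2)[OF this]
      show "a (Suc k mod l) = i \<and> (if k = l - 1 then j else k) = j \<or> a (Suc k mod l) < m \<and>
          (if k = l - 1 then j else k) < n \<and> sat_adj l (a (Suc k mod l)) (if k = l - 1 then j else k)"
        using a(3) l core ij k last[OF k] by (auto simp: sat_adj_def)
    qed (rule a)
  next
    case pendant_core
    \<comment> \<open>The cycle leaves the core at \<open>j\<close>, takes the new edge to
      \<open>i\<close> and returns through \<open>v\<close> to \<open>0\<close>. The transposition
      in \<open>?b\<close> places \<open>j\<close> last among the core right vertices; the left
      vertex \<open>l - 1\<close> is skipped.\<close>
    let ?a = "\<lambda>k. if k = l - 1 then i else k"
    let ?b = "\<lambda>k. if k = l - 1 then l - 1 else transpose j (l - 2) k"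
    have b: "?b k < l - 1" if "k < l - 1" for k
      using that pendant_core by (auto simp: transpose_def)
    show ?thesis
    proof (rule cyc[of ?a ?b])
      show "inj_on ?a {..<l}" using pendant_core by (auto simp: inj_on_def)
      show "inj_on ?b {..<l}" using pendant_core by (auto simp: inj_on_def transpose_def split: if_splits)
    next
      fix k assume k: "k < l"
      consider "k = l - 1" | "k < l - 1" using k by linarith
      then show "?a k = i \<and> ?b k = j \<or> ?a k < m \<and> ?b k < n \<and> sat_adj l (?a k) (?b k)"
        using k b[of k] l pendant_core ij by cases (auto simp: sat_adj_def)
      consider "k = l - 1" | "k = l - 2" | "k < l - 2" using k by linarith
      then show "?a (Suc k mod l) = i \<and> ?b k = j \<or>
          ?a (Suc k mod l) < m \<and> ?b k < n \<and> sat_adj l (?a (Suc k mod l)) (?b k)"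
      proof cases
        case 1
        then have eq: "?a (Suc k mod l) = 0" "?b k = l - 1" using l by auto
        have "0 < m" "l - 1 < n" using l by linarith+
        then show ?thesis unfolding eq by (simp add: sat_adj_def)
      next
        case 2
        then have "?a (Suc k mod l) = i" "?b k = j" using l by auto
        then show ?thesis by blast
      next
        case 3
        then have "?a (Suc k mod l) < l" "?b k < l - 1" using b[of k] by auto
        then show ?thesis using core_adj by blast
      qed
    qed
  next
    case pendants
    \<comment> \<open>A core path from \<open>0\<close> to \<open>1\<close> continues through
      \<open>j\<close>, \<open>i\<close> and \<open>v\<close> back to \<open>0\<close>. The
      transposition makes \<open>1\<close> the last core left vertex and, as \<open>l\<close> is at
      least 3, leaves \<open>0\<close> in front.\<close>
    let ?a = "\<lambda>k. if k = l - 1 then i else transpose 1 (l - 2) k"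
    let ?b = "\<lambda>k. if k = l - 1 then l - 1 else if k = l - 2 then j else k"
    have a: "?a k < l" if "k < l - 1" for k
      using that l by (auto simp: transpose_def)
    have a0: "?a 0 = 0" using l by (auto simp: transpose_def)
    show ?thesis
    proof (rule cyc[of ?a ?b])
      show "inj_on ?a {..<l}"
        using pendants l by (auto simp: inj_on_def transpose_def split: if_splits)
      show "inj_on ?b {..<l}" using pendants by (auto simp: inj_on_def)
    next
      fix k assume k: "k < l"
      consider "k = l - 1" | "k = l - 2" | "k < l - 2" using k by linarith
      then show "?a k = i \<and> ?b k = j \<or> ?a k < m \<and> ?b k < n \<and> sat_adj l (?a k) (?b k)"
      proof cases
        case 1
        then show ?thesis using l pendants ij by (simp add: sat_adj_def)
      next
        case 2
        then have "?a k = 1" "?b k = j" using l by auto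
        then show ?thesis using l pendants ij by (simp only: sat_adj_def) auto
      next
        case 3
        then have "?a k < l" "?b k < l - 1" using a[of k] by auto
        then show ?thesis using core_adj by blast
      qed
      consider "k = l - 1" | "k = l - 2" | "k < l - 2" using k by linarith
      then show "?a (Suc k mod l) = i \<and> ?b k = j \<or>
          ?a (Suc k mod l) < m \<and> ?b k < n \<and> sat_adj l (?a (Suc k mod l)) (?b k)"
      proof cases
        case 1
        then have eq: "?a (Suc k mod l) = 0" "?b k = l - 1" using a0 l by auto
        have "0 < m" "l - 1 < n" using l by linarith+
        then show ?thesis unfolding eq by (simp add: sat_adj_def)
      next
        case 2
        then have "?a (Suc k mod l) = i" "?b k = j" using l by auto
        then show ?thesis by blast
      next
        case 3
        then have "Suc k mod l = Suc k" "Suc k < l - 1" "?b k < l - 1" by auto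
        then have "?a (Suc k mod l) < l" using a[of "Suc k"] by simp
        then show ?thesis using \<open>?b k < l - 1\<close> core_adj by blast
      qed
    qed
  qed
qed

lemma sat_graph_saturated:
  assumes "3 \<le> l" "l \<le> m" "l \<le> n"
  shows "saturated_in (complete_bipartite m n) (cycle_graph (2 * l)) (sat_graph l m n)"
proof -
  have "spanning_subgraph (sat_graph l m n) (complete_bipartite m n)"
    by (auto simp: spanning_subgraph_def sat_graph_def complete_bipartite_def)
  moreover have "contains_copy (add_edge (sat_graph l m n) e) (cycle_graph (2 * l))"
    if e: "e \<in> edges (complete_bipartite m n) - edges (sat_graph l m n)" for e
  proof -
    obtain i j where "e = {Inl i, Inr j}" "i < m" "j < n"
      using e unfolding complete_bipartite_def ugraph.sel by blast
    then show ?thesis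
      using e sat_graph_saturated_aux[OF assms] edge_sat_graph[of i j l m n] by auto
  qed
  ultimately show ?thesis
    using sat_graph_no_cycle[OF assms(1)] by (auto simp: saturated_in_def)
qed

section \<open>The bounds on \<open>sat\<close>\<close>

lemma sat_cycle_upper_bound:
  assumes "3 \<le> l" "l \<le> m" "l \<le> n"
  shows "int (sat (complete_bipartite m n) (cycle_graph (2 * l)))
    \<le> int m + int n + (int l)\<^sup>2 - 3 * int l + 1"
proof -
  have "sat (complete_bipartite m n) (cycle_graph (2 * l)) \<le> l * (l - 1) + 1 + (m - l) + (n - l)"
    unfolding sat_def using sat_graph_saturated[OF assms] card_edges_sat_graph[OF assms]
    by (intro Least_le) blast
  then have "int (sat (complete_bipartite m n) (cycle_graph (2 * l)))
      \<le> int (l * (l - 1) + 1 + (m - l) + (n - l))"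
    by linarith
  also have "\<dots> = int m + int n + (int l)\<^sup>2 - 3 * int l + 1"
  proof -
    \<comment> \<open>Removes the truncated subtraction in \<open>l - 1\<close> before passing to
      integers.\<close>
    obtain k where "l = Suc k" using assms by (cases l) auto
    then show ?thesis using assms by (simp add: of_nat_diff power2_eq_square algebra_simps)
  qed
  finally show ?thesis .
qed

theorem theorem1p1:
  shows "(\<forall>l n1 n2 :: nat. 3 \<le> l \<longrightarrow> l + 2 \<le> n1 \<longrightarrow> l + 2 \<le> n2 \<longrightarrow>
            int (sat (complete_bipartite n1 n2) (cycle_graph (2 * l)))
              \<le> int n1 + int n2 + (int l)^2 - 3 * int l + 1) \<and>
         (\<forall>n1 n2 :: nat. 5 \<le> n1 \<longrightarrow> 5 \<le> n2 \<longrightarrow>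
            sat (complete_bipartite n1 n2) (cycle_graph 6) = n1 + n2 + 1)"
proof (intro conjI allI impI)
  fix n1 n2 :: nat assume n: "5 \<le> n1" "5 \<le> n2"
  \<comment> \<open>The construction with \<open>l = 3\<close> shows that saturated graphs exist, so
    the minimum is attained and the lower bound applies to a minimiser.\<close>
  have "\<exists>H. saturated_in (complete_bipartite n1 n2) (cycle_graph 6) H \<and>
      card (edges H) = sat (complete_bipartite n1 n2) (cycle_graph 6)"
    unfolding sat_def
    by (rule LeastI_ex) (use sat_graph_saturated[of 3 n1 n2] n in auto)
  then have "n1 + n2 + 1 \<le> sat (complete_bipartite n1 n2) (cycle_graph 6)"
    using saturated_hexagon_card[OF n] by metis
  moreover have "sat (complete_bipartite n1 n2) (cycle_graph 6) \<le> n1 + n2 + 1"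
    \<comment> \<open>For \<open>l = 3\<close> the term \<open>l^2 - 3 * l\<close> vanishes, so the
      two bounds meet.\<close>
    using sat_cycle_upper_bound[of 3 n1 n2] n by simp
  ultimately show "sat (complete_bipartite n1 n2) (cycle_graph 6) = n1 + n2 + 1"
    by simp
qed (simp add: sat_cycle_upper_bound)

end
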